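(* For every $n\ge 1$, the number of blue edges and the number of red edges in the $n$-th iteration of the Collatz path graph are given by the Fibonacci sequence out of phase by one iteration, namely $B(n)=F_n$ and $R(n)=F_{n+1}$; moreover $$\lim_{n\to+\infty}\frac{B(n)}{R(n)}=\frac{1}{2}\left(\sqrt{5}-1\right)=\frac{1}{\varphi},$$ where $\varphi=\frac{1}{2}(1+\sqrt{5})$ is the golden ratio.
   Context: The Collatz path graph is the infinite rooted tree of all formally possible paths of the Collatz algorithm, with edges colored red (an even event) or blue (an odd event). From the root (iteration 0) there is one red edge and one blue edge (iteration 1). Each red edge is continued in the next iteration by one red edge and one blue edge, and each blue edge is continued in the next iteration by exactly one red edge. $R(n)$ and $B(n)$ denote respectively the number of red and blue edges at iteration $n$; thus $R(1)=B(1)=1$, $R(n+1)=R(n)+B(n)$ and $B(n+1)=R(n)$. $F_n$ is the Fibonacci sequence with $F_1=F_2=1$, $F_{n+2}=F_{n+1}+F_n$. *)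

theory Defs
  imports Complex_Main "HOL-Number_Theory.Fib" "Graph_Theory.Digraph"
begin

text \<open>Red edges stand for even events of the Collatz algorithm, blue edges for odd events.\<close>

datatype colour = Red | Blue

text \<open>A vertex of the tree is encoded by the colours met on the way from the root, the root
  being the empty word; the edge entering a vertex has the last letter of its word as colour.\<close>

inductive_set collatz_vertices :: "colour list set" where
  root: "[] \<in> collatz_vertices"
| from_root: "[c] \<in> collatz_vertices"
| after_red: "p @ [Red] \<in> collatz_vertices \<Longrightarrow> p @ [Red, c] \<in> collatz_vertices"
| after_blue: "p @ [Blue] \<in> collatz_vertices \<Longrightarrow> p @ [Blue, Red] \<in> collatz_vertices"

definition collatz_path_graph :: "(colour list, colour list \<times> colour list) pre_digraph" where
  "collatz_path_graph =
    \<lparr>verts = collatz_vertices,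
     arcs = {(p, p @ [c]) | p c. p \<in> collatz_vertices \<and> p @ [c] \<in> collatz_vertices},
     tail = fst,
     head = snd\<rparr>"

definition edge_colour :: "colour list \<times> colour list \<Rightarrow> colour" where
  "edge_colour e = last (head collatz_path_graph e)"

text \<open>The iteration of an edge is the depth of its head, so that the edges leaving the root
  are at iteration 1.\<close>

definition edge_iteration :: "colour list \<times> colour list \<Rightarrow> nat" where
  "edge_iteration e = length (head collatz_path_graph e)"

definition edges_at :: "colour \<Rightarrow> nat \<Rightarrow> (colour list \<times> colour list) set" where
  "edges_at c n =
    {e \<in> arcs collatz_path_graph. edge_iteration e = n \<and> edge_colour e = c}"

definition num_red :: "nat \<Rightarrow> nat" where
  "num_red n = card (edges_at Red n)"

definition num_blue :: "nat \<Rightarrow> nat" where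
  "num_blue n = card (edges_at Blue n)"

definition golden_ratio :: real where
  "golden_ratio = (1/2) * (1 + sqrt 5)"

end

theory Submission
  imports Defs
begin

text \<open>An edge is determined by its tail and its colour, and the edge entering that tail is its
  predecessor. A red edge may follow either colour, a blue edge only red. Hence R(n+1) = R(n) + B(n)
  and B(n+1) = R(n), the Fibonacci recursion with both counts starting at 1
  (\<open>tails_of_edges_Suc\<close>, \<open>card_tails_of_edges\<close>). The limit then follows
  from the asymptotic form of Binet's formula, \<open>fib n\<close> ~
  \<open>golden_ratio ^ n / sqrt 5\<close>.\<close>

text \<open>Inverts the inductive rules into a recursion on the last letter. The case
  \<open>p = []\<close> stands apart because \<open>last []\<close> is unspecified and the root
  allows both colours.\<close>

lemma snoc_in_collatz_vertices_iff:
  "p @ [c] \<in> collatz_vertices \<longleftrightarrow>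
    p = [] \<or> p \<in> collatz_vertices \<and> (c = Red \<or> last p = Red)"
proof
  assume "p @ [c] \<in> collatz_vertices"
  then show "p = [] \<or> p \<in> collatz_vertices \<and> (c = Red \<or> last p = Red)"
  proof cases
    case (after_red q d)
    then have "p = q @ [Red]" by (metis append_Cons append_Nil append_assoc butlast_snoc)
    with after_red show ?thesis by simp
  next
    case (after_blue q)
    then have "p = q @ [Blue]" "c = Red"
      by (metis append_Cons append_Nil append_assoc butlast_snoc,
          metis after_blue(1) last.simps last_appendR last_snoc list.distinct(1))
    with after_blue show ?thesis by simp
  qed auto
next
  assume R: "p = [] \<or> p \<in> collatz_vertices \<and> (c = Red \<or> last p = Red)"
  show "p @ [c] \<in> collatz_vertices"
  proof (cases p rule: rev_cases)
    case Nil
    then show ?thesis by (simp add: from_root)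
  next
    case (snoc q d)
    then show ?thesis
      using R after_red[of q c] after_blue[of q] by (cases d) auto
  qed
qed

text \<open>Encodes the edges of iteration \<open>n + 1\<close> by their tails, so that the
  recursion starts at 0 and runs over words instead of pairs.\<close>

definition tails_of_edges :: "colour \<Rightarrow> nat \<Rightarrow> colour list set" where
  "tails_of_edges c n = {p. length p = n \<and> p @ [c] \<in> collatz_vertices}"

lemma tails_of_edges_0: "tails_of_edges c 0 = {[]}"
  by (auto simp: tails_of_edges_def from_root)

lemma tails_of_edges_Suc:
  "tails_of_edges Red (Suc n) =
    (\<lambda>q. q @ [Red]) ` tails_of_edges Red n \<union> (\<lambda>q. q @ [Blue]) ` tails_of_edges Blue n"
  "tails_of_edges Blue (Suc n) = (\<lambda>q. q @ [Red]) ` tails_of_edges Red n"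
proof -
  have step: "p \<in> tails_of_edges c (Suc n) \<longleftrightarrow>
      (\<exists>q d. p = q @ [d] \<and> q \<in> tails_of_edges d n \<and> (c = Red \<or> d = Red))" for p c
    \<comment> \<open>The instance for words with at least two letters peels off only the last one
      and leaves \<open>q @ [d] \<in> collatz_vertices\<close> intact, as membership in
      \<open>tails_of_edges d n\<close> requires.\<close>
    by (cases p rule: rev_cases)
      (auto simp: tails_of_edges_def snoc_in_collatz_vertices_iff[of "_ @ [_]", simplified])
  show "tails_of_edges Red (Suc n) =
      (\<lambda>q. q @ [Red]) ` tails_of_edges Red n \<union> (\<lambda>q. q @ [Blue]) ` tails_of_edges Blue n"
    unfolding set_eq_iff step by (auto simp: image_iff) (metis colour.exhaust)+
  show "tails_of_edges Blue (Suc n) = (\<lambda>q. q @ [Red]) ` tails_of_edges Red n"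
    unfolding set_eq_iff step by auto
qed

text \<open>The recursion couples the two colours, so both are treated in one induction; finiteness
  is carried along to add the cardinalities of the disjoint union.\<close>

lemma card_tails_of_edges:
  "finite (tails_of_edges Red n) \<and> finite (tails_of_edges Blue n) \<and>
   card (tails_of_edges Red n) = fib (n + 2) \<and> card (tails_of_edges Blue n) = fib (n + 1)"
proof (induction n)
  case 0
  then show ?case by (simp add: tails_of_edges_0 numeral_2_eq_2)
next
  case (Suc n)
  have "(\<lambda>q. q @ [Red]) ` tails_of_edges Red n \<inter> (\<lambda>q. q @ [Blue]) ` tails_of_edges Blue n = {}"
    by auto
  with Suc show ?case
    by (simp add: tails_of_edges_Suc card_Un_disjoint card_image inj_on_def)
qed

lemma edges_at_Suc: "edges_at c (Suc n) = (\<lambda>p. (p, p @ [c])) ` tails_of_edges c n"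
proof -
  \<comment> \<open>Vertices are closed under removing the last letter, so an arc is given by its
    head alone.\<close>
  have "p \<in> collatz_vertices" if "p @ [d] \<in> collatz_vertices" for p d
    using that root by (auto simp: snoc_in_collatz_vertices_iff)
  then show ?thesis
    by (fastforce simp: edges_at_def tails_of_edges_def collatz_path_graph_def
        edge_iteration_def edge_colour_def)
qed

lemma card_edges_at_Suc: "card (edges_at c (Suc n)) = card (tails_of_edges c n)"
  by (simp add: edges_at_Suc card_image inj_on_def)

lemma num_blue_eq_fib: "n \<ge> 1 \<Longrightarrow> num_blue n = fib n"
  by (cases n) (simp_all add: num_blue_def card_edges_at_Suc card_tails_of_edges)

lemma num_red_eq_fib: "n \<ge> 1 \<Longrightarrow> num_red n = fib (n + 1)"
  by (cases n) (simp_all add: num_red_def card_edges_at_Suc card_tails_of_edges)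

lemma fib_ratio_tendsto: "(\<lambda>n. real (fib n) / real (fib (n + 1))) \<longlonglongrightarrow> 1 / golden_ratio"
proof -
  let ?a = "\<lambda>n. real (fib n) / (golden_ratio ^ n / sqrt 5)"
  have pos: "golden_ratio > 0"
    by (simp add: golden_ratio_def add_pos_nonneg)
  have lim: "?a \<longlonglongrightarrow> 1"
    using fib_asymptotics by (simp add: golden_ratio_def)
  \<comment> \<open>In the quotient of consecutive terms \<open>sqrt 5\<close> cancels and the
    powers leave one factor \<open>golden_ratio\<close>, which the last division removes.\<close>
  have "(\<lambda>n. ?a n / ?a (Suc n) / golden_ratio) \<longlonglongrightarrow> 1 / 1 / golden_ratio"
    using pos by (intro tendsto_intros lim LIMSEQ_Suc[OF lim]) auto
  moreover have "?a n / ?a (Suc n) / golden_ratio = real (fib n) / real (fib (n + 1))" for n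
    using pos by (simp add: field_simps)
  ultimately show ?thesis by simp
qed

lemma inverse_golden_ratio: "(1/2) * (sqrt 5 - 1) = 1 / golden_ratio"
proof -
  have "(1/2) * (sqrt 5 - 1) * golden_ratio = 1"
    by (simp add: golden_ratio_def algebra_simps)
  then show ?thesis
    by (metis eq_divide_eq mult_zero_right zero_neq_one)
qed

theorem mainTheorem3:
  "(\<forall>n\<ge>1. num_blue n = fib n \<and> num_red n = fib (n + 1)) \<and>
   (\<lambda>n. real (num_blue n) / real (num_red n)) \<longlonglongrightarrow> (1/2) * (sqrt 5 - 1) \<and>
   (1/2) * (sqrt 5 - 1) = 1 / golden_ratio"
proof (intro conjI inverse_golden_ratio)
  show "\<forall>n\<ge>1. num_blue n = fib n \<and> num_red n = fib (n + 1)"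
    using num_blue_eq_fib num_red_eq_fib by blast
  \<comment> \<open>Iteration 0 has no edges while \<open>fib 1 = 1\<close>, so the closed forms are
    applied only from 1 on, which suffices for the limit.\<close>
  have "\<forall>\<^sub>F n in sequentially.
      real (num_blue n) / real (num_red n) = real (fib n) / real (fib (n + 1))"
    using eventually_ge_at_top[of 1]
    by eventually_elim (simp add: num_blue_eq_fib num_red_eq_fib)
  then show "(\<lambda>n. real (num_blue n) / real (num_red n)) \<longlonglongrightarrow> (1/2) * (sqrt 5 - 1)"
    using fib_ratio_tendsto unfolding inverse_golden_ratio by (simp only: tendsto_cong)
qed

end
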